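(* Let $1\le m<n$, suppose $2m<s<n$, and let $\mu$ be a finite nonzero Borel measure on $\mathbb{R}^n$ with compact support and $I_{s}(\mu)<\infty$. Then $$\gamma_{n,m}\left(\{V\in G(n,m): 0\in \operatorname{Int}(P_V(\operatorname{spt}\mu))\}\right)>0.$$
   Context: $I_s(\mu)=\iint|x-y|^{-s}\,d\mu x\,d\mu y$ is the $s$-energy and $\operatorname{spt}\mu$ the support of $\mu$. $G(n,m)$ is the Grassmannian of $m$-dimensional linear subspaces of $\mathbb{R}^n$, $\gamma_{n,m}$ its orthogonally invariant Borel probability measure, $P_V$ the orthogonal projection onto $V$, and $\operatorname{Int}$ the interior relative to $V$. *)

theory Defs
  imports "HOL-Analysis.Analysis"
begin

definition energy :: "real \<Rightarrow> 'a::euclidean_space measure \<Rightarrow> ennreal" where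
  "energy s \<mu> = (\<integral>\<^sup>+ x. (\<integral>\<^sup>+ y. (if x = y then \<infinity> else ennreal (dist x y powr (- s))) \<partial>\<mu>) \<partial>\<mu>)"

definition spt :: "'a::metric_space measure \<Rightarrow> 'a set" where
  "spt \<mu> = {x. \<forall>e>0. emeasure \<mu> (ball x e) > 0}"

definition grassmannian :: "nat \<Rightarrow> 'a::euclidean_space set set" where
  "grassmannian m = {V. subspace V \<and> dim V = m}"

definition proj :: "'a::euclidean_space set \<Rightarrow> 'a \<Rightarrow> 'a" where
  "proj V x = (THE p. p \<in> V \<and> (\<forall>v\<in>V. inner (x - p) v = 0))"

definition rel_int_in :: "'a::topological_space set \<Rightarrow> 'a set \<Rightarrow> 'a set" where
  "rel_int_in V S = \<Union>{T. openin (top_of_set V) T \<and> T \<subseteq> S}"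

definition std_gauss :: "'a::euclidean_space measure" where
  "std_gauss = density lborel
     (\<lambda>x. ennreal ((2 * pi) powr (- real DIM('a) / 2) * exp (- (norm x)\<^sup>2 / 2)))"

text \<open>The orthogonally invariant probability measure gamma_{n,m} on G(n,m), realised as the
  law of the span of m independent standard Gaussian vectors (which is a.s. m-dimensional).
  It is evaluated on a family \<V> of subspaces.\<close>
definition gamma_nm :: "nat \<Rightarrow> 'a::euclidean_space set set \<Rightarrow> ennreal" where
  "gamma_nm m \<V> = emeasure (PiM {..<m} (\<lambda>_. (std_gauss :: 'a measure)))
      {v \<in> space (PiM {..<m} (\<lambda>_. (std_gauss :: 'a measure))).
         span (v ` {..<m}) \<in> grassmannian m \<inter> \<V>}"

end

theory Submission
  imports Defs "HOL-Probability.Probability"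
begin

text \<open>
  Write \<open>A v x = (v j \<bullet> x)\<^sub>j\<close> for a Gaussian frame \<open>v\<close>. The Fourier transform of the image of \<open>\<mu>\<close>
  under \<open>A v\<close> satisfies \<open>E |\<phi> v t|\<^sup>2 = \<integral>\<integral> exp (- |t|\<^sup>2 |x - y|\<^sup>2 / 2) d\<mu> d\<mu>\<close>, which the energy
  bounds by a multiple of \<open>|t|\<close> to the power \<open>- s\<close>; as \<open>s > 2 m\<close>, \<open>\<phi> v\<close> is almost surely integrable
  over \<open>\<real>\<^sup>m\<close>, and its inverse transform \<open>f v\<close> is the continuous density of the image measure.
  Since \<open>E (f v 0)\<close> is a positive multiple of \<open>\<integral>\<integral> exp (- |t|\<^sup>2 |x|\<^sup>2 / 2) d\<mu> dt > 0\<close>, the density is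
  nonzero at, hence near, the origin with positive probability, and there the image of the support
  covers a neighbourhood of the origin. Covering a neighbourhood forces \<open>A v\<close> to be onto, so the
  frame is then automatically linearly independent.
\<close>

section \<open>Gaussian integrals\<close>

text \<open>The integral is \<open>char std_normal_distribution z\<close>, whose closed form is
  known.\<close>

lemma
  fixes z :: real
  shows integrable_std_normal_iexp: "integrable lborel (\<lambda>u. complex_of_real (std_normal_density u) * iexp (u * z))"
    and integral_std_normal_iexp:
      "(LINT u|lborel. complex_of_real (std_normal_density u) * iexp (u * z)) = exp (- z\<^sup>2 / 2)"
proof -
  show "integrable lborel (\<lambda>u. complex_of_real (std_normal_density u) * iexp (u * z))"
    by (rule Bochner_Integration.integrable_bound[OF integrable_normal_density[of 1 0]])
       (auto simp: norm_mult)
  have "(LINT u|lborel. complex_of_real (std_normal_density u) * iexp (u * z))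
      = char std_normal_distribution z"
    unfolding char_def
    by (subst integral_density) (auto simp: scaleR_conv_of_real mult.commute)
  then show "(LINT u|lborel. complex_of_real (std_normal_density u) * iexp (u * z)) = exp (- z\<^sup>2 / 2)"
    by (simp add: char_std_normal_distribution)
qed

text \<open>The substitution \<open>\<sigma> * u\<close> reduces this to the standard normal
  density. A wide Gaussian in \<open>u\<close> becomes a peak of width \<open>\<sigma>\<close> in
  \<open>z\<close>, the form in which it later mollifies.\<close>

lemma
  fixes z \<sigma> :: real
  assumes "\<sigma> > 0"
  shows integrable_gaussian_iexp:
      "integrable lborel (\<lambda>u. complex_of_real (exp (- (\<sigma> * u)\<^sup>2 / 2)) * iexp (u * z))"
    and integral_gaussian_iexp:
      "(LINT u|lborel. complex_of_real (exp (- (\<sigma> * u)\<^sup>2 / 2)) * iexp (u * z))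
        = sqrt (2 * pi) / \<sigma> * exp (- (z / \<sigma>)\<^sup>2 / 2)"
proof -
  let ?f = "\<lambda>u. complex_of_real (std_normal_density u) * iexp (u * (z / \<sigma>))"
  have eq: "complex_of_real (exp (- (\<sigma> * u)\<^sup>2 / 2)) * iexp (u * z)
      = sqrt (2 * pi) * ?f (0 + \<sigma> * u)" for u
    using assms by (simp add: std_normal_density_def)
  have "integrable lborel (\<lambda>u. ?f (0 + \<sigma> * u))"
    by (rule lborel_integrable_real_affine[OF integrable_std_normal_iexp]) (use assms in simp)
  then show "integrable lborel (\<lambda>u. complex_of_real (exp (- (\<sigma> * u)\<^sup>2 / 2)) * iexp (u * z))"
    unfolding eq by (rule integrable_mult_right)
  have "integral\<^sup>L lborel ?f = \<bar>\<sigma>\<bar> *\<^sub>R (LINT u|lborel. ?f (0 + \<sigma> * u))"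
    by (rule lborel_integral_real_affine) (use assms in simp)
  then have *: "(LINT u|lborel. ?f (0 + \<sigma> * u)) = exp (- (z / \<sigma>)\<^sup>2 / 2) / \<sigma>"
    using assms unfolding integral_std_normal_iexp by (simp add: scaleR_conv_of_real field_simps)
  show "(LINT u|lborel. complex_of_real (exp (- (\<sigma> * u)\<^sup>2 / 2)) * iexp (u * z))
        = sqrt (2 * pi) / \<sigma> * exp (- (z / \<sigma>)\<^sup>2 / 2)"
    unfolding eq integral_mult_right_zero * using assms by simp
qed

interpretation lborel_product: product_sigma_finite "\<lambda>_::'i. lborel :: real measure"
  by standard

text \<open>Lebesgue measure on a Euclidean space is the image under \<open>?T\<close> of a product
  of one-dimensional Lebesgue measures, so the product rule for integrals applies.\<close>

lemma integral_lborel_prod: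
  fixes f :: "'a::euclidean_space \<Rightarrow> real \<Rightarrow> complex"
  assumes f: "\<And>b. b \<in> Basis \<Longrightarrow> integrable lborel (f b)"
  shows "(LINT x|lborel. (\<Prod>b\<in>Basis. f b (x \<bullet> b))) = (\<Prod>b\<in>Basis. integral\<^sup>L lborel (f b))"
proof -
  note [measurable] = borel_measurable_integrable[OF f]
  let ?P = "PiM (Basis :: 'a set) (\<lambda>_. lborel :: real measure)"
  let ?T = "\<lambda>g::'a \<Rightarrow> real. \<Sum>b\<in>Basis. g b *\<^sub>R b"
  have P: "(\<Prod>b\<in>Basis. f b (?T g \<bullet> b)) = (\<Prod>b\<in>Basis. f b (g b))" for g :: "'a \<Rightarrow> real"
    by (intro prod.cong) auto
  have T[measurable]: "?T \<in> ?P \<rightarrow>\<^sub>M borel" by measurable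
  have M[measurable]: "(\<lambda>x::'a. \<Prod>b\<in>Basis. f b (x \<bullet> b)) \<in> borel_measurable borel"
    by measurable
  show "(LINT x|lborel. (\<Prod>b\<in>Basis. f b (x \<bullet> b))) = (\<Prod>b\<in>Basis. integral\<^sup>L lborel (f b))"
    unfolding lborel_eq[where 'a='a]
    by (subst integral_distr)
       (auto simp: P intro!: lborel_product.product_integral_prod f)
qed

lemma sum_Basis_inner_sq_half:
  fixes x :: "'a::euclidean_space"
  shows "(\<Sum>b\<in>(Basis::'a set). - (x \<bullet> b)\<^sup>2 / 2) = - (norm x)\<^sup>2 / 2"
  unfolding norm_eq_sqrt_inner euclidean_inner[of x x]
  by (simp add: sum_nonneg power2_eq_square sum_negf sum_divide_distrib)

text \<open>Splitting the density over the basis lets integrals against \<open>std_gauss\<close>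
  factor into one-dimensional ones.\<close>

lemma std_gauss_density_prod:
  fixes x :: "'a::euclidean_space"
  shows "(2 * pi) powr (- real DIM('a) / 2) * exp (- (norm x)\<^sup>2 / 2)
    = (\<Prod>b\<in>Basis. std_normal_density (x \<bullet> b))"
proof -
  have "(\<Prod>b\<in>(Basis::'a set). std_normal_density (x \<bullet> b))
     = (1 / sqrt (2 * pi)) ^ DIM('a) * exp (\<Sum>b\<in>(Basis::'a set). - (x \<bullet> b)\<^sup>2 / 2)"
    unfolding std_normal_density_def prod.distrib by (simp add: exp_sum)
  also have "(\<Sum>b\<in>(Basis::'a set). - (x \<bullet> b)\<^sup>2 / 2) = - (norm x)\<^sup>2 / 2"
    by (rule sum_Basis_inner_sq_half)
  also have "(1 / sqrt (2 * pi)) ^ DIM('a) = (2 * pi) powr (- real DIM('a) / 2)"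
  proof -
    have "1 / sqrt (2 * pi) = (2 * pi) powr (- (1/2))"
      by (simp only: powr_minus_divide powr_half_sqrt[of "2 * pi"] pi_ge_zero mult_nonneg_nonneg zero_le_numeral)
    then have "(1 / sqrt (2 * pi)) ^ DIM('a) = ((2 * pi) powr (- (1/2))) powr real DIM('a)"
      by (simp only: powr_realpow' powr_ge_zero) (simp add: powr_realpow)
    also have "\<dots> = (2 * pi) powr (- (1/2) * real DIM('a))" by (rule powr_powr)
    finally show ?thesis by (simp only: minus_divide_left mult_minus_left) simp
  qed
  finally show ?thesis by simp
qed

lemma sets_std_gauss [simp, measurable_cong]: "sets std_gauss = sets borel"
  and space_std_gauss [simp]: "space std_gauss = UNIV"
  by (simp_all add: std_gauss_def)

lemma integral_std_gauss_iexp: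
  fixes x :: "'a::euclidean_space"
  shows "(LINT g|std_gauss. iexp (g \<bullet> x)) = exp (- (norm x)\<^sup>2 / 2)"
proof -
  have "(LINT g|std_gauss. iexp (g \<bullet> x))
     = (LINT g|lborel. (\<Prod>b\<in>Basis. complex_of_real (std_normal_density (g \<bullet> b)) * iexp ((g \<bullet> b) * (x \<bullet> b))))"
    unfolding std_gauss_def std_gauss_density_prod
    by (subst integral_density)
       (auto simp: scaleR_conv_of_real prod.distrib prod_nonneg exp_sum[symmetric] sum_distrib_left[symmetric]
          of_real_sum[symmetric] euclidean_inner[of _ x] simp del: of_real_sum of_real_mult)
  also have "\<dots> = (\<Prod>b\<in>Basis. complex_of_real (exp (- (x \<bullet> b)\<^sup>2 / 2)))"
    by (subst integral_lborel_prod[OF integrable_std_normal_iexp])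
       (simp only: integral_std_normal_iexp)
  also have "\<dots> = exp (\<Sum>b\<in>(Basis::'a set). - (x \<bullet> b)\<^sup>2 / 2)"
    by (simp add: exp_sum)
  also have "(\<Sum>b\<in>(Basis::'a set). - (x \<bullet> b)\<^sup>2 / 2) = - (norm x)\<^sup>2 / 2"
    by (rule sum_Basis_inner_sq_half)
  finally show ?thesis .
qed

lemma prob_space_std_gauss: "prob_space (std_gauss :: 'a::euclidean_space measure)"
proof
  have "emeasure std_gauss (space (std_gauss :: 'a measure))
     = (\<integral>\<^sup>+ g. (\<Prod>b\<in>(Basis :: 'a set). ennreal (std_normal_density (g \<bullet> b))) \<partial>lborel)"
    unfolding std_gauss_def std_gauss_density_prod
    by (subst emeasure_density) (auto simp: prod_ennreal)
  also have "\<dots> = 1"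
    by (subst nn_integral_lborel_prod) (auto simp: nn_integral_eq_integral)
  finally show "emeasure std_gauss (space (std_gauss :: 'a measure)) = 1" .
qed

section \<open>Frames and projections\<close>

text \<open>The complement is a union of open null balls, and by Lindelof's theorem countably many
  of them have the same union.\<close>

lemma null_sets_Compl_spt:
  fixes \<mu> :: "'a::euclidean_space measure"
  assumes "sets \<mu> = sets borel"
  shows "- spt \<mu> \<in> null_sets \<mu>"
proof -
  define F where "F = {ball x e | x e. e > 0 \<and> emeasure \<mu> (ball x e) = 0}"
  have "\<And>S. S \<in> F \<Longrightarrow> open S" by (auto simp: F_def)
  then obtain F' where F': "F' \<subseteq> F" "countable F'" "\<Union>F' = \<Union>F"
    using Lindelof[of F] by blast
  have N: "\<Union>F' \<in> null_sets \<mu>"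
    using F' by (intro null_sets_UN'[of F' "\<lambda>S. S", simplified]) (auto simp: F_def null_sets_def assms)
  have sub: "- spt \<mu> \<subseteq> \<Union>F"
  proof
    fix x assume "x \<in> - spt \<mu>"
    then obtain e where "e > 0" "emeasure \<mu> (ball x e) = 0"
      by (auto simp: spt_def not_less)
    then show "x \<in> \<Union>F" unfolding F_def by (force intro!: exI[of _ "ball x e"])
  qed
  \<comment> \<open>Equality with the union, not just inclusion, makes the complement itself
    measurable.\<close>
  have "\<Union>F \<subseteq> - spt \<mu>"
  proof
    fix y assume "y \<in> \<Union>F"
    then obtain x e where xe: "y \<in> ball x e" "emeasure \<mu> (ball x e) = 0" by (auto simp: F_def)
    then obtain d where d: "d > 0" "ball y d \<subseteq> ball x e"
      using open_contains_ball[of "ball x e"] open_ball by metis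
    then have "emeasure \<mu> (ball y d) \<le> emeasure \<mu> (ball x e)"
      by (intro emeasure_mono) (auto simp: assms)
    with d xe show "y \<in> - spt \<mu>" by (auto simp: spt_def)
  qed
  with sub N F' show ?thesis by auto
qed

text \<open>Two candidates differ by a vector of \<open>V\<close> orthogonal to itself, which
  settles the uniqueness demanded by \<open>THE\<close> in \<open>proj\<close>.\<close>

lemma proj_eqI:
  fixes V :: "'a::euclidean_space set"
  assumes "subspace V" "p \<in> V" "\<And>v. v \<in> V \<Longrightarrow> (x - p) \<bullet> v = 0"
  shows "proj V x = p"
  unfolding Defs.proj_def
proof (rule the_equality)
  show "p \<in> V \<and> (\<forall>v\<in>V. (x - p) \<bullet> v = 0)" using assms by auto
next
  fix q assume q: "q \<in> V \<and> (\<forall>v\<in>V. (x - q) \<bullet> v = 0)"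
  then have "p - q \<in> V" using assms by (auto intro: subspace_diff)
  then have "(x - q) \<bullet> (p - q) = 0" "(x - p) \<bullet> (p - q) = 0" using q assms by auto
  then have "(p - q) \<bullet> (p - q) = 0" by (simp add: algebra_simps)
  then show "q = p" by simp
qed

text \<open>The orthogonal decomposition of \<open>x\<close> supplies the vector that
  \<open>proj_eqI\<close> asks for. Frame coordinates thus pass unchanged to the projection.\<close>

lemma proj_inner:
  fixes V :: "'a::euclidean_space set"
  assumes "subspace V" and "v \<in> V"
  shows "v \<bullet> proj V x = v \<bullet> x"
proof -
  obtain p z where "p \<in> span V" "\<And>w. w \<in> span V \<Longrightarrow> orthogonal z w" "x = p + z"
    using orthogonal_subspace_decomp_exists[of V x] by metis
  then have *: "p \<in> V" "\<And>w. w \<in> V \<Longrightarrow> (x - p) \<bullet> w = 0"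
    using assms by (auto simp: orthogonal_def span_eq_iff[THEN iffD2])
  then have p: "proj V x = p" using assms by (intro proj_eqI)
  show ?thesis using p assms(2) *(2)[of v] by (simp add: inner_diff_left inner_commute[of v])
qed

text \<open>The coordinates of \<open>x\<close> with respect to a frame \<open>v\<close> are the inner products \<open>v j \<bullet> x\<close>;
  they determine the projection of \<open>x\<close> to the span of the frame.\<close>
definition covers_zero :: "nat \<Rightarrow> 'a::euclidean_space set \<Rightarrow> (nat \<Rightarrow> 'a) \<Rightarrow> real \<Rightarrow> bool" where
  "covers_zero m K v \<delta> \<longleftrightarrow>
    (\<forall>y. (\<forall>j<m. \<bar>y j\<bar> < \<delta>) \<longrightarrow> (\<exists>x\<in>K. \<forall>j<m. v j \<bullet> x = y j))"

lemma inner_eq_zero_span: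
  assumes "\<And>w. w \<in> S \<Longrightarrow> z \<bullet> w = 0" "u \<in> span S"
  shows "z \<bullet> u = 0"
  using assms(2,1) by (induction rule: span_induct_alt) (auto simp: inner_add_right)

text \<open>Hitting a target on each coordinate axis makes the frame independent. A point of
  \<open>K\<close> with the same coordinates as some \<open>p\<close> in \<open>V\<close> projects
  to \<open>p\<close>.\<close>

lemma covers_zero_imp_interior:
  fixes v :: "nat \<Rightarrow> 'a::euclidean_space"
  assumes "\<delta> > 0" and cov: "covers_zero m K v \<delta>"
  defines "V \<equiv> span (v ` {..<m})"
  shows "V \<in> grassmannian m" "0 \<in> rel_int_in V (proj V ` K)"
proof -
  \<comment> \<open>The target with single nonzero entry \<open>\<delta> / 2\<close> lies in the
    open cube; a preimage of it is, up to scale, dual to \<open>v i\<close>.\<close>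
  have "\<exists>x. \<forall>j<m. v j \<bullet> x = (if j = i then \<delta> / 2 else 0)" for i
  proof -
    have "\<forall>j<m. \<bar>if j = i then \<delta> / 2 else 0\<bar> < \<delta>" using assms(1) by simp
    from cov[unfolded covers_zero_def, THEN spec, THEN mp, OF this] show ?thesis
      by (elim bexE) (rule exI)
  qed
  then obtain w where w: "\<And>i j. j < m \<Longrightarrow> v j \<bullet> w i = (if j = i then \<delta> / 2 else 0)"
    by metis
  have nin: "v i \<notin> span (v ` ({..<m} - {i}))" if "i < m" for i
  proof
    assume "v i \<in> span (v ` ({..<m} - {i}))"
    then have "w i \<bullet> v i = 0"
      by (rule inner_eq_zero_span[rotated]) (auto simp: inner_commute[of "w i"] w split: if_splits)
    then show False using w[of i i] that assms(1) by (simp add: inner_commute[of "w i"])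
  qed
  \<comment> \<open>Repeated vectors must be excluded, so that the basis has exactly
    \<open>m\<close> elements.\<close>
  have inj: "inj_on v {..<m}"
  proof (rule inj_onI, rule ccontr)
    fix i j assume "i \<in> {..<m}" "j \<in> {..<m}" "v i = v j" "i \<noteq> j"
    then have "v i \<in> v ` ({..<m} - {i})" by auto
    then show False using nin[of i] span_base[of "v i"] \<open>i \<in> {..<m}\<close> by simp
  qed
  have "independent (v ` {..<m})"
    unfolding dependent_def
  proof safe
    fix i assume i: "i < m" "v i \<in> span (v ` {..<m} - {v i})"
    have "v ` {..<m} - {v i} \<subseteq> v ` ({..<m} - {i})" by auto
    then show False using i nin[of i] span_mono[THEN subsetD] by metis
  qed
  then have "dim V = m"
    unfolding V_def using inj by (simp add: dim_eq_card_independent card_image)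
  then show "V \<in> grassmannian m" by (auto simp: grassmannian_def V_def)
  \<comment> \<open>The preimage of the covered cube under the frame coordinates, cut with
    \<open>V\<close>, serves as the open neighbourhood of 0.\<close>
  define T where "T = V \<inter> {p. \<forall>j\<in>{..<m}. \<bar>v j \<bullet> p\<bar> < \<delta>}"
  have "open (\<Inter>j\<in>{..<m}. {p. \<bar>v j \<bullet> p\<bar> < \<delta>})"
    by (intro open_INT) (auto intro!: open_Collect_less continuous_intros)
  moreover have "(\<Inter>j\<in>{..<m}. {p. \<bar>v j \<bullet> p\<bar> < \<delta>}) = {p. \<forall>j\<in>{..<m}. \<bar>v j \<bullet> p\<bar> < \<delta>}" by auto
  ultimately have "openin (top_of_set V) T"
    unfolding T_def by (auto simp: openin_open)
  moreover have "T \<subseteq> proj V ` K"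
  proof
    fix p assume p: "p \<in> T"
    then obtain x where x: "x \<in> K" "\<And>j. j < m \<Longrightarrow> v j \<bullet> x = v j \<bullet> p"
      using cov[unfolded covers_zero_def, rule_format, of "\<lambda>j. v j \<bullet> p"] by (auto simp: T_def)
    have "proj V x = p"
    proof (rule proj_eqI)
      show "subspace V" "p \<in> V" using p by (auto simp: V_def T_def)
      fix u assume "u \<in> V"
      then show "(x - p) \<bullet> u = 0" unfolding V_def
        by (rule inner_eq_zero_span[rotated]) (auto simp: inner_diff_left x inner_commute[of _ "v _"])
    qed
    with x show "p \<in> proj V ` K" by auto
  qed
  moreover have "0 \<in> T" using assms(1) by (auto simp: T_def V_def span_zero)
  ultimately show "0 \<in> rel_int_in V (proj V ` K)" by (auto simp: rel_int_in_def)
qed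

text \<open>A basis of \<open>V\<close> dual to the frame turns small coordinates \<open>y\<close>
  into a small vector of \<open>V\<close>, which lies in the projection of \<open>K\<close>. This
  converse is needed to identify the event in \<open>gamma_nm\<close> exactly with a covering
  event.\<close>

lemma interior_imp_covers_zero:
  fixes v :: "nat \<Rightarrow> 'a::euclidean_space" and m :: nat
  defines "V \<equiv> span (v ` {..<m})"
  assumes V: "V \<in> grassmannian m" and int: "0 \<in> rel_int_in V (proj V ` K)"
  shows "\<exists>\<delta>>0. covers_zero m K v \<delta>"
proof -
  have sV: "subspace V" by (simp add: V_def)
  \<comment> \<open>If \<open>v i\<close> were redundant, fewer than \<open>m\<close> vectors would
    span \<open>V\<close>.\<close>
  have nin: "v i \<notin> span (v ` ({..<m} - {i}))" if "i < m" for i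
  proof
    assume i: "v i \<in> span (v ` ({..<m} - {i}))"
    have "v ` {..<m} = insert (v i) (v ` ({..<m} - {i}))" using that by auto
    then have "V = span (v ` ({..<m} - {i}))"
      unfolding V_def using i span_redundant by metis
    then have "dim V \<le> card (v ` ({..<m} - {i}))"
      by (simp add: dim_le_card')
    also have "\<dots> \<le> card ({..<m} - {i})" by (rule card_image_le) simp
    also have "\<dots> < m" using that by simp
    finally show False using V by (simp add: grassmannian_def)
  qed
  have "\<exists>w\<in>V. \<forall>j<m. v j \<bullet> w = (if j = i then 1 else 0)" if "i < m" for i
  proof -
    \<comment> \<open>The dual vector is the component \<open>z\<close> of \<open>v i\<close>
      orthogonal to the other frame vectors, divided by
      \<open>v i \<bullet> z = z \<bullet> z\<close>.\<close>
    obtain p z where pz: "p \<in> span (v ` ({..<m} - {i}))"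
      "\<And>w. w \<in> span (v ` ({..<m} - {i})) \<Longrightarrow> orthogonal z w" "v i = p + z"
      using orthogonal_subspace_decomp_exists[of "v ` ({..<m} - {i})" "v i"] by metis
    have "z \<noteq> 0" using nin[OF that] pz by auto
    then have z0: "z \<bullet> z \<noteq> 0" by simp
    have "p \<in> V" unfolding V_def using pz(1) span_mono[of "v ` ({..<m} - {i})" "v ` {..<m}"] by blast
    moreover have "v i \<in> V" unfolding V_def using that by (auto intro: span_base)
    ultimately have zV: "z \<in> V" using pz(3) sV by (metis add_diff_cancel_left' subspace_diff)
    have "v j \<bullet> z = 0" if "j < m" "j \<noteq> i" for j
      using that pz(2)[of "v j"] by (auto simp: orthogonal_def inner_commute intro: span_base)
    moreover have "v i \<bullet> z = z \<bullet> z"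
      using pz(2)[OF pz(1)] unfolding pz(3) inner_add_left by (simp add: orthogonal_def inner_commute)
    ultimately show ?thesis using zV z0 sV
      by (intro bexI[of _ "(1 / (z \<bullet> z)) *\<^sub>R z"]) (auto simp: subspace_scale)
  qed
  then obtain w where w: "\<And>i. i < m \<Longrightarrow> w i \<in> V"
    "\<And>i j. i < m \<Longrightarrow> j < m \<Longrightarrow> v j \<bullet> w i = (if j = i then 1 else 0)"
    by metis
  obtain T where T: "openin (top_of_set V) T" "T \<subseteq> proj V ` K" "0 \<in> T"
    using int by (auto simp: rel_int_in_def)
  then obtain e where e: "e > 0" "\<And>p. p \<in> V \<Longrightarrow> norm p < e \<Longrightarrow> p \<in> T"
    unfolding openin_euclidean_subtopology_iff by (force simp: dist_norm)
  \<comment> \<open>Coordinates below \<open>e / (S + 1)\<close> give \<open>p\<close> norm at most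
    \<open>e / (S + 1) * S < e\<close>; the added 1 keeps the denominator positive.\<close>
  define S where "S = (\<Sum>i<m. norm (w i))"
  have S: "S \<ge> 0" by (auto simp: S_def intro: sum_nonneg)
  show ?thesis
  proof (intro exI[of _ "e / (S + 1)"] conjI)
    show "0 < e / (S + 1)" using e S by auto
    show "covers_zero m K v (e / (S + 1))"
      unfolding covers_zero_def
    proof safe
      fix y :: "nat \<Rightarrow> real" assume y: "\<forall>j<m. \<bar>y j\<bar> < e / (S + 1)"
      define p where "p = (\<Sum>i<m. y i *\<^sub>R w i)"
      have "p \<in> V" unfolding p_def using w sV by (auto intro!: subspace_sum subspace_scale)
      have "norm p \<le> (\<Sum>i<m. \<bar>y i\<bar> * norm (w i))"
        unfolding p_def by (rule order_trans[OF norm_sum]) simp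
      also have "\<dots> \<le> (\<Sum>i<m. e / (S + 1) * norm (w i))"
        using y by (intro sum_mono mult_right_mono) (auto intro: less_imp_le)
      also have "\<dots> = e / (S + 1) * S" by (simp add: S_def sum_distrib_left)
      also have "\<dots> < e" using S e by (simp add: field_simps)
      finally have "p \<in> T" using e \<open>p \<in> V\<close> by auto
      then obtain x where x: "x \<in> K" "p = proj V x" using T by auto
      have "v j \<bullet> x = y j" if "j < m" for j
      proof -
        have "v j \<in> V" using that by (auto simp: V_def intro: span_base)
        then have "v j \<bullet> x = v j \<bullet> p" using x proj_inner[OF sV, of "v j" x] by simp
        also have "\<dots> = (\<Sum>i<m. y i * (if j = i then 1 else 0))"
          unfolding p_def inner_sum_right using w that by (intro sum.cong) auto
        also have "\<dots> = y j" using that by (subst sum.remove[of _ j]) auto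
        finally show ?thesis .
      qed
      with x show "\<exists>x\<in>K. \<forall>j<m. v j \<bullet> x = y j" by auto
    qed
  qed
qed

section \<open>Measurability of the covering event\<close>

text \<open>Compactness of \<open>K\<close> upgrades approximate solutions in \<open>D\<close> at
  rational targets to exact solutions in \<open>K\<close> at all targets. Once \<open>D\<close> is
  countable, every quantifier ranges over a countable set; \<open>PiE\<close> fixes the values
  outside the index set to keep the targets countable.\<close>

lemma covers_zero_iff_countable:
  fixes K :: "'a::euclidean_space set"
  assumes K: "compact K" and D: "D \<subseteq> K" "K \<subseteq> closure D"
  shows "covers_zero m K v \<delta> \<longleftrightarrow>
    (\<forall>q\<in>PiE {..<m} (\<lambda>_. \<rat> \<inter> {-\<delta><..<\<delta>}). \<forall>k. \<exists>x\<in>D. \<forall>j<m. \<bar>v j \<bullet> x - q j\<bar> < inverse (real (Suc k)))"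
    (is "_ \<longleftrightarrow> (\<forall>q\<in>?Q. ?R q)")
proof
  assume cov: "covers_zero m K v \<delta>"
  show "\<forall>q\<in>?Q. ?R q"
  proof safe
    fix q :: "nat \<Rightarrow> real" and k assume q: "q \<in> ?Q"
    have "\<forall>j<m. \<bar>q j\<bar> < \<delta>" using q by (auto simp: PiE_def Pi_def abs_less_iff)
    then obtain x where x: "x \<in> K" "\<And>j. j < m \<Longrightarrow> v j \<bullet> x = q j"
      using cov by (auto simp: covers_zero_def)
    define U where "U = (\<Inter>j\<in>{..<m}. {z. \<bar>v j \<bullet> z - q j\<bar> < inverse (real (Suc k))})"
    have "open U" unfolding U_def
      by (intro open_INT) (auto intro!: open_Collect_less continuous_intros)
    moreover have "x \<in> U" using x by (auto simp: U_def)
    ultimately obtain z where "z \<in> D" "z \<in> U"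
      using x D open_Int_closure_eq_empty[of U D] by blast
    then show "\<exists>x\<in>D. \<forall>j<m. \<bar>v j \<bullet> x - q j\<bar> < inverse (real (Suc k))" by (auto simp: U_def)
  qed
next
  assume R: "\<forall>q\<in>?Q. ?R q"
  show "covers_zero m K v \<delta>" unfolding covers_zero_def
  proof safe
    fix y :: "nat \<Rightarrow> real" assume y: "\<forall>j<m. \<bar>y j\<bar> < \<delta>"
    have near: "\<exists>x\<in>K. \<forall>j<m. \<bar>v j \<bullet> x - y j\<bar> < \<epsilon>" if "\<epsilon> > 0" for \<epsilon>
    proof -
      \<comment> \<open>Clipping the interval at the faces of the cube keeps the rational target
        admissible.\<close>
      have "\<exists>r\<in>\<rat>. max (- \<delta>) (y j - \<epsilon> / 2) < r \<and> r < min \<delta> (y j + \<epsilon> / 2)" if "j < m" for j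
        using y that \<open>\<epsilon> > 0\<close> by (intro Rats_dense_in_real) (force simp: abs_less_iff)
      then obtain r where r: "\<And>j. j < m \<Longrightarrow> r j \<in> \<rat>"
        "\<And>j. j < m \<Longrightarrow> max (- \<delta>) (y j - \<epsilon> / 2) < r j \<and> r j < min \<delta> (y j + \<epsilon> / 2)"
        by metis
      have "restrict r {..<m} \<in> ?Q" using r by auto
      moreover obtain k where k: "inverse (real (Suc k)) < \<epsilon> / 2"
        using reals_Archimedean[of "\<epsilon> / 2"] \<open>\<epsilon> > 0\<close> by auto
      ultimately obtain x where x: "x \<in> D" "\<forall>j<m. \<bar>v j \<bullet> x - r j\<bar> < inverse (real (Suc k))"
        using R by (metis lessThan_iff restrict_apply')
      have "\<bar>v j \<bullet> x - y j\<bar> < \<epsilon>" if "j < m" for j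
        using x(2)[rule_format, OF that] r(2)[OF that] k by auto
      with x D show ?thesis by auto
    qed
    \<comment> \<open>The total error is continuous with infimum 0 over \<open>K\<close>, so a
      minimiser solves the system exactly.\<close>
    define g where "g x = (\<Sum>j<m. \<bar>v j \<bullet> x - y j\<bar>)" for x
    have "continuous_on K g" unfolding g_def by (intro continuous_intros)
    moreover have "K \<noteq> {}" using near[of 1] by auto
    ultimately obtain x where x: "x \<in> K" "\<And>z. z \<in> K \<Longrightarrow> g x \<le> g z"
      using continuous_attains_inf[OF K] by blast
    have "g x \<le> 0"
    proof (rule field_le_epsilon)
      fix e :: real assume "e > 0"
      then obtain z where z: "z \<in> K" "\<forall>j<m. \<bar>v j \<bullet> z - y j\<bar> < e / (real m + 1)"
        using near[of "e / (real m + 1)"] by auto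
      have "g z \<le> (\<Sum>j<m. e / (real m + 1))"
        unfolding g_def using z by (intro sum_mono) (auto intro: less_imp_le)
      also have "\<dots> \<le> e" using \<open>e > 0\<close> by (simp add: field_simps)
      finally show "g x \<le> 0 + e" using x(2)[OF z(1)] by simp
    qed
    moreover have "\<bar>v j \<bullet> x - y j\<bar> \<le> g x" if "j < m" for j
      unfolding g_def using that by (intro member_le_sum) auto
    ultimately have "\<forall>j<m. v j \<bullet> x = y j" by (metis abs_le_zero_iff eq_iff_diff_eq_0 order_trans)
    with x show "\<exists>x\<in>K. \<forall>j<m. v j \<bullet> x = y j" by auto
  qed
qed

lemma covers_zero_antimono: "covers_zero m K v \<delta> \<Longrightarrow> \<epsilon> \<le> \<delta> \<Longrightarrow> covers_zero m K v \<epsilon>"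
  unfolding covers_zero_def by (intro allI impI, erule allE, erule mp) (auto dest: less_le_trans)

text \<open>By monotonicity \<open>\<delta>\<close> may run through the numbers
  \<open>inverse (real (Suc n))\<close>. Countable unions and intersections of finite systems of
  inequalities remain.\<close>

lemma measurable_covers_zero:
  fixes K :: "'a::euclidean_space set"
  assumes K: "compact K"
  shows "Measurable.pred (PiM {..<m} (\<lambda>_. borel)) (\<lambda>v. \<exists>\<delta>>0. covers_zero m K v \<delta>)"
proof -
  obtain D where D: "countable D" "D \<subseteq> K" "K \<subseteq> closure D"
    using separable[of K] by metis
  have cD: "countable (PiE {..<m} (\<lambda>_. \<rat> \<inter> {-\<delta><..<\<delta>}))" for \<delta> :: real
    by (intro countable_PiE) (auto intro: countable_rat countable_Int1)
  have eq: "(\<exists>\<delta>>0. covers_zero m K v \<delta>) \<longleftrightarrow> (\<exists>n::nat. covers_zero m K v (inverse (real (Suc n))))" for v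
  proof safe
    fix \<delta> :: real assume "\<delta> > 0" "covers_zero m K v \<delta>"
    then show "\<exists>n::nat. covers_zero m K v (inverse (real (Suc n)))"
      by (meson covers_zero_antimono less_imp_le reals_Archimedean)
  next
    fix n :: nat assume "covers_zero m K v (inverse (real (Suc n)))"
    then show "\<exists>\<delta>>0. covers_zero m K v \<delta>" by (intro exI conjI) auto
  qed
  have fin: "Measurable.pred (PiM {..<m} (\<lambda>_. borel)) (\<lambda>v. \<forall>j<m. \<bar>v j \<bullet> x - q j\<bar> < \<epsilon>)" for x :: 'a and q \<epsilon>
    unfolding lessThan_iff[symmetric] Ball_def[symmetric] by measurable
  show ?thesis
    unfolding eq unfolding covers_zero_iff_countable[OF K D(2,3)]
    unfolding pred_def
    by (intro sets.sets_Collect_countable_Ex sets.sets_Collect_countable_All'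
        sets.sets_Collect_countable_All sets.sets_Collect_countable_Ex' cD D(1) fin[unfolded pred_def])
qed

section \<open>Gaussian frames and frequencies\<close>

interpretation gauss_product: product_sigma_finite "\<lambda>_::'i. std_gauss :: 'a::euclidean_space measure"
  by (intro product_sigma_finite.intro prob_space_imp_sigma_finite prob_space_std_gauss)

abbreviation gauss_frames :: "nat \<Rightarrow> (nat \<Rightarrow> 'a::euclidean_space) measure" where
  "gauss_frames m \<equiv> PiM {..<m} (\<lambda>_. std_gauss)"

abbreviation frequencies :: "nat \<Rightarrow> (nat \<Rightarrow> real) measure" where
  "frequencies m \<equiv> PiM {..<m} (\<lambda>_. lborel)"

lemma prob_space_gauss_frames: "prob_space (gauss_frames m)"
  by (intro prob_space_PiM prob_space_std_gauss)

lemma sigma_finite_frequencies: "sigma_finite_measure (frequencies m)"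
  by (rule lborel_product.sigma_finite) simp

lemma emeasure_frequencies_nonzero: "emeasure (frequencies m) (space (frequencies m)) \<noteq> 0"
  by (simp add: space_PiM lborel_product.emeasure_PiM)

lemma iexp_sum: "iexp (sum f A) = (\<Prod>j\<in>A. iexp (f j))"
  by (cases "finite A") (simp_all add: exp_sum sum_distrib_left)

text \<open>The integral factors over the independent frame vectors; each factor is the Gaussian
  characteristic function at \<open>t j *\<^sub>R x\<close>.\<close>

lemma integral_gauss_frames_iexp:
  fixes x :: "'a::euclidean_space"
  shows "(LINT v|gauss_frames m. iexp (\<Sum>j<m. t j * (v j \<bullet> x)))
    = complex_of_real (exp (- (\<Sum>j<m. (t j)\<^sup>2) * (norm x)\<^sup>2 / 2))"
proof -
  interpret prob_space "std_gauss :: 'a measure" by (rule prob_space_std_gauss)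
  have int: "integrable std_gauss (\<lambda>g::'a. iexp (t j * (g \<bullet> x)))" for j
    by (rule integrable_const_bound[of _ 1]) auto
  have "(LINT g|std_gauss. iexp (t j * (g \<bullet> x))) = complex_of_real (exp (- (norm (t j *\<^sub>R x))\<^sup>2 / 2))" for j
    using integral_std_gauss_iexp[of "t j *\<^sub>R x"] by simp
  then have "(LINT v|gauss_frames m. iexp (\<Sum>j<m. t j * (v j \<bullet> x)))
      = (\<Prod>j<m. complex_of_real (exp (- (norm (t j *\<^sub>R x))\<^sup>2 / 2)))"
    unfolding iexp_sum by (subst gauss_product.product_integral_prod[OF _ int]) auto
  also have "\<dots> = complex_of_real (exp (\<Sum>j<m. - (norm (t j *\<^sub>R x))\<^sup>2 / 2))"
    by (simp add: exp_sum)
  also have "(\<Sum>j<m. - (norm (t j *\<^sub>R x))\<^sup>2 / 2) = - (\<Sum>j<m. (t j)\<^sup>2) * (norm x)\<^sup>2 / 2"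
    by (simp add: power_mult_distrib sum_negf sum_distrib_right sum_divide_distrib)
  finally show ?thesis .
qed

lemma
  fixes z :: "nat \<Rightarrow> real" and \<sigma> :: real
  assumes "\<sigma> > 0"
  shows integrable_frequencies_gaussian:
      "integrable (frequencies m) (\<lambda>t. \<Prod>j<m. complex_of_real (exp (- (\<sigma> * t j)\<^sup>2 / 2)) * iexp (t j * z j))"
    and integral_frequencies_gaussian:
      "(LINT t|frequencies m. (\<Prod>j<m. complex_of_real (exp (- (\<sigma> * t j)\<^sup>2 / 2)) * iexp (t j * z j)))
        = (\<Prod>j<m. sqrt (2 * pi) / \<sigma> * exp (- (z j / \<sigma>)\<^sup>2 / 2))"
proof -
  show "integrable (frequencies m) (\<lambda>t. \<Prod>j<m. complex_of_real (exp (- (\<sigma> * t j)\<^sup>2 / 2)) * iexp (t j * z j))"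
    by (rule lborel_product.product_integrable_prod[OF _ integrable_gaussian_iexp[OF assms]]) simp
  show "(LINT t|frequencies m. (\<Prod>j<m. complex_of_real (exp (- (\<sigma> * t j)\<^sup>2 / 2)) * iexp (t j * z j)))
        = (\<Prod>j<m. sqrt (2 * pi) / \<sigma> * exp (- (z j / \<sigma>)\<^sup>2 / 2))"
    by (subst lborel_product.product_integral_prod[OF _ integrable_gaussian_iexp[OF assms]])
       (simp_all only: integral_gaussian_iexp[OF assms] finite_lessThan of_real_prod)
qed

section \<open>Polynomial decay bounds for Gaussians\<close>

text \<open>On the half-line there is an explicit primitive, which tends to 0 at infinity because
  \<open>a > 1\<close>; reflection handles the other half.\<close>

lemma integrable_one_plus_abs_powr:
  fixes a :: real
  assumes "a > 1"
  shows "integrable lborel (\<lambda>u. (1 + \<bar>u\<bar>) powr - a)"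
proof -
  have "(\<integral>\<^sup>+u. ennreal ((1 + u) powr - a) * indicator {0..} u \<partial>lborel)
      = ennreal (0 - (1 + 0) powr (1 - a) / (1 - a))"
  proof (rule nn_integral_FTC_atLeast)
    show "((\<lambda>u. (1 + u) powr (1 - a) / (1 - a)) \<longlongrightarrow> 0) at_top"
      using assms
      by (intro tendsto_divide_zero tendsto_neg_powr filterlim_tendsto_add_at_top[OF tendsto_const]
          filterlim_ident) auto
    fix u :: real assume u: "0 \<le> u"
    show "((\<lambda>u. (1 + u) powr (1 - a) / (1 - a)) has_real_derivative (1 + u) powr - a) (at u)"
    proof -
      have "((\<lambda>u. (1 + u) powr (1 - a)) has_real_derivative (1 - a) * (1 + u) powr (1 - a - 1) * 1) (at u)"
        by (rule DERIV_chain2[OF has_real_derivative_powr]) (use u in \<open>auto intro!: derivative_eq_intros\<close>)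
      from DERIV_cdivide[OF this, of "1 - a"] show ?thesis using assms by simp
    qed
  qed auto
  then have fin: "(\<integral>\<^sup>+u. ennreal ((1 + u) powr - a) * indicator {0..} u \<partial>lborel) < \<infinity>"
    by simp
  have "(\<integral>\<^sup>+u. ennreal ((1 + \<bar>u\<bar>) powr - a) \<partial>lborel)
     \<le> (\<integral>\<^sup>+u. ennreal ((1 + u) powr - a) * indicator {0..} u
              + ennreal ((1 - u) powr - a) * indicator {0..} (- u) \<partial>lborel)"
    by (intro nn_integral_mono) (auto simp: indicator_def)
  also have "\<dots> = (\<integral>\<^sup>+u. ennreal ((1 + u) powr - a) * indicator {0..} u \<partial>lborel)
     + (\<integral>\<^sup>+u. ennreal ((1 - u) powr - a) * indicator {0..} (- u) \<partial>lborel)"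
    by (intro nn_integral_add) auto
  also have "(\<integral>\<^sup>+u. ennreal ((1 - u) powr - a) * indicator {0..} (- u) \<partial>lborel)
     = (\<integral>\<^sup>+u. ennreal ((1 + u) powr - a) * indicator {0..} u \<partial>lborel)"
    by (subst nn_integral_real_affine[of _ "-1" 0]) auto
  finally have "(\<integral>\<^sup>+u. ennreal ((1 + \<bar>u\<bar>) powr - a) \<partial>lborel) < \<infinity>"
    by (rule le_less_trans) (use fin in simp)
  then show ?thesis
    by (intro integrableI_bounded) auto
qed

text \<open>A product weight replaces a negative power of the Euclidean norm, so that integrability
  over the frequencies reduces to dimension one.\<close>

definition decay :: "real \<Rightarrow> nat \<Rightarrow> (nat \<Rightarrow> real) \<Rightarrow> real" where
  "decay a m t = (\<Prod>j<m. (1 + \<bar>t j\<bar>) powr - a)"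

lemma decay_pos: "decay a m t > 0"
  unfolding decay_def by (intro prod_pos) (auto simp: add_pos_nonneg)

lemma integrable_decay:
  assumes "a > 1"
  shows "integrable (frequencies m) (decay a m)"
  unfolding decay_def
  by (rule lborel_product.product_integrable_prod) (auto intro: integrable_one_plus_abs_powr assms)

text \<open>With \<open>z = \<bar>u\<bar> * min 1 r\<close>, the power
  \<open>((1 + \<bar>u\<bar>) * min 1 r) powr (2 * a)\<close> is at most
  \<open>exp (2 * a * z)\<close>, which the Gaussian in \<open>z\<close> absorbs up to a
  constant.\<close>

lemma exp_gaussian_le_powr:
  fixes a r u :: real
  assumes "a \<ge> 0" "r > 0"
  shows "exp (- (u * r)\<^sup>2 / 2) \<le> exp (2 * a\<^sup>2) * ((1 + \<bar>u\<bar>) powr - a)\<^sup>2 * (min 1 r powr - (2 * a))"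
proof -
  \<comment> \<open>Truncation at 1 is what gives
    \<open>(1 + \<bar>u\<bar>) * \<rho> \<le> 1 + z\<close>.\<close>
  define \<rho> where "\<rho> = min 1 r"
  have \<rho>: "0 < \<rho>" "\<rho> \<le> 1" "\<rho> \<le> r" using assms by (auto simp: \<rho>_def)
  define z where "z = \<bar>u\<bar> * \<rho>"
  have z: "z \<ge> 0" using \<rho> by (simp add: z_def)
  have "\<bar>u\<bar> * \<rho> \<le> \<bar>u\<bar> * r" using \<rho> by (intro mult_left_mono) auto
  then have "z\<^sup>2 \<le> (\<bar>u\<bar> * r)\<^sup>2" using z unfolding z_def by (intro power_mono) auto
  then have 1: "exp (- (u * r)\<^sup>2 / 2) \<le> exp (- z\<^sup>2 / 2)" by (simp add: power_mult_distrib)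
  have "((1 + \<bar>u\<bar>) * \<rho>) powr (2 * a) \<le> (exp z) powr (2 * a)"
  proof (rule powr_mono2)
    have "(1 + \<bar>u\<bar>) * \<rho> \<le> 1 + z" using \<rho> by (simp add: z_def algebra_simps)
    also have "\<dots> \<le> exp z" by (rule exp_ge_add_one_self)
    finally show "(1 + \<bar>u\<bar>) * \<rho> \<le> exp z" .
  qed (use assms \<rho> in auto)
  also have "(exp z) powr (2 * a) = exp (2 * a * z)" by (simp add: powr_def)
  \<comment> \<open>This is \<open>(2 * a - z)\<^sup>2 \<ge> 0\<close>, expanded and halved.\<close>
  also have "\<dots> \<le> exp (2 * a\<^sup>2 + z\<^sup>2 / 2)"
    using sum_squares_ge_zero[of "2 * a - z" 0] by (simp add: power2_eq_square algebra_simps)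
  finally have "((1 + \<bar>u\<bar>) * \<rho>) powr (2 * a) * exp (- z\<^sup>2 / 2) \<le> exp (2 * a\<^sup>2 + z\<^sup>2 / 2) * exp (- z\<^sup>2 / 2)"
    by (rule mult_right_mono) simp
  then have 2: "((1 + \<bar>u\<bar>) * \<rho>) powr (2 * a) * exp (- z\<^sup>2 / 2) \<le> exp (2 * a\<^sup>2)"
    by (simp add: exp_add[symmetric])
  have 3: "((1 + \<bar>u\<bar>) powr - a)\<^sup>2 * (\<rho> powr - (2 * a)) * ((1 + \<bar>u\<bar>) * \<rho>) powr (2 * a) = 1"
  proof -
    have "(p powr - a)\<^sup>2 * (\<rho> powr - (2 * a)) * (p * \<rho>) powr (2 * a) = 1" if "p > 0" for p :: real
    proof -
      have "(p powr - a)\<^sup>2 = p powr - (2 * a)"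
        by (simp add: power2_eq_square powr_add[symmetric])
      then show ?thesis using that \<rho> by (simp add: powr_mult powr_minus) (simp add: field_simps)
    qed
    then show ?thesis by (simp add: add_pos_nonneg)
  qed
  have "exp (- z\<^sup>2 / 2) = ((1 + \<bar>u\<bar>) powr - a)\<^sup>2 * (\<rho> powr - (2 * a)) *
      (((1 + \<bar>u\<bar>) * \<rho>) powr (2 * a) * exp (- z\<^sup>2 / 2))"
    using 3 by (metis mult.assoc mult_1)
  also have "\<dots> \<le> ((1 + \<bar>u\<bar>) powr - a)\<^sup>2 * (\<rho> powr - (2 * a)) * exp (2 * a\<^sup>2)"
    by (intro mult_left_mono 2) auto
  finally show ?thesis using order_trans[OF 1] unfolding \<rho>_def[symmetric] by (simp only: mult_ac)
qed

text \<open>The one-dimensional bounds multiply, and their exponents \<open>2 * a\<close> add up to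
  \<open>2 * a * real m\<close>, the exponent of the energy kernel. The summand 1 covers distances
  above 1.\<close>

lemma exp_gaussian_le_decay:
  fixes a r :: real
  assumes "a \<ge> 0" "r > 0"
  shows "exp (- (\<Sum>j<m. (t j)\<^sup>2) * r\<^sup>2 / 2)
    \<le> exp (2 * a\<^sup>2) ^ m * (decay a m t)\<^sup>2 * (1 + r powr - (2 * a * real m))"
proof -
  have "exp (- (\<Sum>j<m. (t j)\<^sup>2) * r\<^sup>2 / 2) = (\<Prod>j<m. exp (- (t j * r)\<^sup>2 / 2))"
    by (simp add: exp_sum[symmetric] power_mult_distrib sum_negf sum_distrib_right sum_divide_distrib)
  also have "\<dots> \<le> (\<Prod>j<m. exp (2 * a\<^sup>2) * ((1 + \<bar>t j\<bar>) powr - a)\<^sup>2 * (min 1 r powr - (2 * a)))"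
    by (intro prod_mono conjI exp_gaussian_le_powr assms) auto
  also have "\<dots> = exp (2 * a\<^sup>2) ^ m * (decay a m t)\<^sup>2 * (min 1 r powr - (2 * a)) ^ m"
    by (simp add: prod.distrib decay_def prod_power_distrib)
  also have "(min 1 r powr - (2 * a)) ^ m = min 1 r powr (- (2 * a) * real m)"
    using assms by (subst powr_realpow[symmetric]) (auto simp: powr_powr)
  also have "\<dots> \<le> 1 + r powr - (2 * a * real m)"
    using assms by (cases "r \<le> 1") (auto simp: min_def)
  finally show ?thesis by (simp add: mult_left_mono)
qed

section \<open>The Fourier transform of the projected measures\<close>

locale finite_borel_measure = finite_measure \<mu> for \<mu> :: "'a::euclidean_space measure" +
  assumes sets_eq_borel [measurable_cong]: "sets \<mu> = sets borel"
begin

text \<open>The Fourier transform at \<open>t\<close> of the image of \<mu> under the frame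
  coordinates, called \<open>\<phi> v t\<close> in the introduction.\<close>

definition frame_char :: "nat \<Rightarrow> (nat \<Rightarrow> 'a) \<Rightarrow> (nat \<Rightarrow> real) \<Rightarrow> complex" where
  "frame_char m v t = (LINT x|\<mu>. iexp (\<Sum>j<m. t j * (v j \<bullet> x)))"

lemma borel_measurable_frame_char [measurable]:
  "(\<lambda>p. frame_char m (snd p) (fst p)) \<in> borel_measurable (frequencies m \<Otimes>\<^sub>M gauss_frames m)"
  unfolding frame_char_def by measurable

lemma borel_measurable_frame_char_frame [measurable]:
  "(\<lambda>v. frame_char m v t) \<in> borel_measurable (gauss_frames m)"
  unfolding frame_char_def by measurable

lemma borel_measurable_frame_char_frequency [measurable]:
  "frame_char m v \<in> borel_measurable (frequencies m)"
  unfolding frame_char_def by measurable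

lemma norm_frame_char_le: "norm (frame_char m v t) \<le> measure \<mu> (space \<mu>)"
proof -
  have "norm (frame_char m v t) \<le> (LINT x|\<mu>. norm (iexp (\<Sum>j<m. t j * (v j \<bullet> x))))"
    unfolding frame_char_def by (rule integral_norm_bound)
  then show ?thesis by simp
qed

text \<open>The integrand is bounded on a finite product measure, so Fubini moves the Gaussian
  expectation inside.\<close>

lemma expectation_frame_char:
  "(LINT v|gauss_frames m. frame_char m v t)
    = complex_of_real (LINT x|\<mu>. exp (- (\<Sum>j<m. (t j)\<^sup>2) * (norm x)\<^sup>2 / 2))"
proof -
  interpret G: prob_space "gauss_frames m :: (nat \<Rightarrow> 'a) measure" by (rule prob_space_gauss_frames)
  interpret P: pair_sigma_finite "gauss_frames m :: (nat \<Rightarrow> 'a) measure" \<mu> ..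
  interpret PP: finite_measure "(gauss_frames m :: (nat \<Rightarrow> 'a) measure) \<Otimes>\<^sub>M \<mu>"
    by (intro finite_measure_pair_measure) unfold_locales
  have "integrable (gauss_frames m \<Otimes>\<^sub>M \<mu>) (\<lambda>(v, x). iexp (\<Sum>j<m. t j * (v j \<bullet> x)))"
    by (rule PP.integrable_const_bound[of _ 1]) (auto simp: split_beta')
  from P.Fubini_integral[OF this] show ?thesis
    unfolding frame_char_def integral_gauss_frames_iexp by simp
qed

lemma frame_char_cnj:
  "frame_char m v t * cnj (frame_char m v t)
    = (LINT p|(\<mu> \<Otimes>\<^sub>M \<mu>). iexp (\<Sum>j<m. t j * (v j \<bullet> (fst p - snd p))))"
proof -
  interpret P: pair_sigma_finite \<mu> \<mu> ..
  interpret PP: finite_measure "\<mu> \<Otimes>\<^sub>M \<mu>"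
    by (intro finite_measure_pair_measure) unfold_locales
  let ?e = "\<lambda>x. iexp (\<Sum>j<m. t j * (v j \<bullet> x))"
  have e: "?e (x - y) = ?e x * cnj (?e y)" for x y
    by (simp add: exp_cnj exp_add[symmetric] algebra_simps sum_subtractf)
  have "integrable (\<mu> \<Otimes>\<^sub>M \<mu>) (\<lambda>p. ?e (fst p - snd p))"
    by (rule PP.integrable_const_bound[of _ 1]) auto
  from P.integral_fst'[OF this]
  have "(LINT p|(\<mu> \<Otimes>\<^sub>M \<mu>). ?e (fst p - snd p)) = (LINT x|\<mu>. (LINT y|\<mu>. ?e x * cnj (?e y)))"
    unfolding e by simp
  also have "\<dots> = frame_char m v t * cnj (frame_char m v t)"
    unfolding frame_char_def integral_cnj[symmetric]
    by (simp del: of_real_sum exp_of_real)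
  finally show ?thesis by simp
qed

section \<open>Second moments and integrability of the transform\<close>

text \<open>Writing the square as a product with the conjugate gives a double integral over \<mu>,
  in which the frame enters only through exponentials of known expectation.\<close>

lemma expectation_norm_frame_char_sq:
  "(LINT v|gauss_frames m. (norm (frame_char m v t))\<^sup>2)
    = (LINT p|(\<mu> \<Otimes>\<^sub>M \<mu>). exp (- (\<Sum>j<m. (t j)\<^sup>2) * (norm (fst p - snd p))\<^sup>2 / 2))"
proof -
  interpret M: pair_sigma_finite \<mu> \<mu> ..
  interpret MM: finite_measure "\<mu> \<Otimes>\<^sub>M \<mu>"
    by (intro finite_measure_pair_measure) unfold_locales
  interpret G: prob_space "gauss_frames m :: (nat \<Rightarrow> 'a) measure" by (rule prob_space_gauss_frames)
  interpret P: pair_sigma_finite "gauss_frames m :: (nat \<Rightarrow> 'a) measure" "\<mu> \<Otimes>\<^sub>M \<mu>" ..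
  interpret PP: finite_measure "(gauss_frames m :: (nat \<Rightarrow> 'a) measure) \<Otimes>\<^sub>M (\<mu> \<Otimes>\<^sub>M \<mu>)"
    by (intro finite_measure_pair_measure) unfold_locales
  have int: "integrable (gauss_frames m \<Otimes>\<^sub>M (\<mu> \<Otimes>\<^sub>M \<mu>))
      (\<lambda>(v, p). iexp (\<Sum>j<m. t j * (v j \<bullet> (fst p - snd p))))"
    by (rule PP.integrable_const_bound[of _ 1]) (auto simp: split_beta')
  have "complex_of_real (LINT v|gauss_frames m. (norm (frame_char m v t))\<^sup>2)
      = (LINT v|gauss_frames m. frame_char m v t * cnj (frame_char m v t))"
    unfolding integral_complex_of_real[symmetric] complex_norm_square by simp
  also have "\<dots> = complex_of_real (LINT p|(\<mu> \<Otimes>\<^sub>M \<mu>). exp (- (\<Sum>j<m. (t j)\<^sup>2) * (norm (fst p - snd p))\<^sup>2 / 2))"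
    unfolding frame_char_cnj using P.Fubini_integral[OF int, symmetric]
    unfolding integral_gauss_frames_iexp by simp
  finally show ?thesis by (simp only: of_real_eq_iff)
qed

text \<open>The pointwise bound of the Gaussian by \<open>decay\<close> is integrated over pairs of
  points, where the distance power becomes the energy.\<close>

lemma expectation_norm_frame_char_sq_le:
  fixes a :: real
  assumes "a \<ge> 0" and energy: "energy (2 * a * real m) \<mu> < \<infinity>"
  obtains C where "C \<ge> 0"
    "\<And>t. (LINT v|gauss_frames m. (norm (frame_char m v t))\<^sup>2) \<le> C * (decay a m t)\<^sup>2"
proof -
  let ?s = "2 * a * real m"
  let ?k = "\<lambda>p. if fst p = snd p then \<infinity> else ennreal (dist (fst p) (snd p) powr (- ?s))"
  interpret M: pair_sigma_finite \<mu> \<mu> ..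
  interpret MM: finite_measure "\<mu> \<Otimes>\<^sub>M \<mu>"
    by (intro finite_measure_pair_measure) unfold_locales
  \<comment> \<open>The two summands are the integrals of 1 and of the energy kernel, matching the
    factor \<open>1 + r powr - (2 * a * real m)\<close>.\<close>
  define W where "W = emeasure (\<mu> \<Otimes>\<^sub>M \<mu>) (space (\<mu> \<Otimes>\<^sub>M \<mu>)) + energy ?s \<mu>"
  have W: "W < \<infinity>" using energy MM.emeasure_finite by (simp add: W_def less_top[symmetric])
  have k[measurable]: "?k \<in> borel_measurable (\<mu> \<Otimes>\<^sub>M \<mu>)" by measurable
  have Wk: "W = (\<integral>\<^sup>+p. 1 + ?k p \<partial>(\<mu> \<Otimes>\<^sub>M \<mu>))"
    unfolding W_def energy_def using nn_integral_fst[OF k, unfolded fst_conv snd_conv]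
    by (subst nn_integral_add) auto
  let ?C = "exp (2 * a\<^sup>2) ^ m"
  show thesis
  proof (rule that[of "?C * enn2real W"])
    show "?C * enn2real W \<ge> 0" by simp
    fix t
    let ?g = "\<lambda>p::'a \<times> 'a. exp (- (\<Sum>j<m. (t j)\<^sup>2) * (norm (fst p - snd p))\<^sup>2 / 2)"
    have int: "integrable (\<mu> \<Otimes>\<^sub>M \<mu>) ?g"
      by (rule MM.integrable_const_bound[of _ 1]) (auto simp: sum_nonneg)
    have "ennreal (LINT p|(\<mu> \<Otimes>\<^sub>M \<mu>). ?g p) = (\<integral>\<^sup>+p. ennreal (?g p) \<partial>(\<mu> \<Otimes>\<^sub>M \<mu>))"
      using int by (intro nn_integral_eq_integral[symmetric]) auto
    also have "\<dots> \<le> (\<integral>\<^sup>+p. ennreal (?C * (decay a m t)\<^sup>2) * (1 + ?k p) \<partial>(\<mu> \<Otimes>\<^sub>M \<mu>))"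
    proof (rule nn_integral_mono)
      fix p :: "'a \<times> 'a"
      have pos: "?C * (decay a m t)\<^sup>2 > 0" using decay_pos[of a m t] by simp
      show "ennreal (?g p) \<le> ennreal (?C * (decay a m t)\<^sup>2) * (1 + ?k p)"
      proof (cases "fst p = snd p")
        \<comment> \<open>On the diagonal the kernel is infinite and its coefficient positive, so
          the bound is trivial.\<close>
        case True
        then show ?thesis using decay_pos[of a m t] by (simp add: ennreal_mult_top)
      next
        case False
        then have "?g p \<le> ?C * (decay a m t)\<^sup>2 * (1 + dist (fst p) (snd p) powr - ?s)"
          unfolding dist_norm using assms by (intro exp_gaussian_le_decay) auto
        then have "ennreal (?g p) \<le> ennreal (?C * (decay a m t)\<^sup>2 * (1 + dist (fst p) (snd p) powr - ?s))"
          by (rule ennreal_leI)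
        also have "\<dots> = ennreal (?C * (decay a m t)\<^sup>2) * (1 + ?k p)"
          using False pos by (subst ennreal_mult) (auto simp: ennreal_plus)
        finally show ?thesis .
      qed
    qed
    also have "\<dots> = ennreal (?C * (decay a m t)\<^sup>2) * W"
      unfolding Wk by (rule nn_integral_cmult) measurable
    also have "\<dots> = ennreal (?C * (decay a m t)\<^sup>2 * enn2real W)"
      using W by (subst ennreal_mult) (auto simp: less_top)
    finally have "(LINT p|(\<mu> \<Otimes>\<^sub>M \<mu>). ?g p) \<le> ?C * (decay a m t)\<^sup>2 * enn2real W"
      by (subst (asm) ennreal_le_iff) auto
    then show "(LINT v|gauss_frames m. (norm (frame_char m v t))\<^sup>2) \<le> ?C * enn2real W * (decay a m t)\<^sup>2"
      unfolding expectation_norm_frame_char_sq by (simp add: mult_ac)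
  qed
qed

text \<open>The second moment controls the mean of the modulus by a multiple of
  \<open>decay a m\<close>, whose integral is finite exactly because \<open>a\<close> exceeds
  1.\<close>

lemma integrable_frame_char:
  fixes a :: real
  assumes "a > 1" and energy: "energy (2 * a * real m) \<mu> < \<infinity>"
  shows "integrable (frequencies m \<Otimes>\<^sub>M gauss_frames m) (\<lambda>(t, v). frame_char m v t)"
proof -
  interpret G: prob_space "gauss_frames m :: (nat \<Rightarrow> 'a) measure" by (rule prob_space_gauss_frames)
  interpret L: sigma_finite_measure "frequencies m" by (rule sigma_finite_frequencies)
  interpret P: pair_sigma_finite "frequencies m" "gauss_frames m :: (nat \<Rightarrow> 'a) measure" ..
  obtain C where C: "C \<ge> 0"
    "\<And>t. (LINT v|gauss_frames m. (norm (frame_char m v t))\<^sup>2) \<le> C * (decay a m t)\<^sup>2"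
    using expectation_norm_frame_char_sq_le[of a m] assms by auto
  have int1: "integrable (gauss_frames m) (\<lambda>v. norm (frame_char m v t))" for t
    by (rule G.integrable_const_bound[of _ "measure \<mu> (space \<mu>)"]) (auto simp: norm_frame_char_le)
  have int2: "integrable (gauss_frames m) (\<lambda>v. (norm (frame_char m v t))\<^sup>2)" for t
    by (rule G.integrable_const_bound[of _ "(measure \<mu> (space \<mu>))\<^sup>2"])
       (auto intro!: power_mono norm_frame_char_le)
  have le: "(LINT v|gauss_frames m. norm (frame_char m v t)) \<le> (1 + C) / 2 * decay a m t" for t
  proof -
    let ?h = "decay a m t"
    have h: "?h > 0" by (rule decay_pos)
    \<comment> \<open>Cauchy--Schwarz in its pointwise AM-GM form, with the optimal weight \<open>decay a m t\<close>.\<close>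
    have "norm (frame_char m v t) \<le> ?h / 2 + (norm (frame_char m v t))\<^sup>2 / (2 * ?h)" for v
      using h sum_squares_ge_zero[of "norm (frame_char m v t) - ?h" 0]
      by (simp add: field_simps power2_eq_square)
    then have "(LINT v|gauss_frames m. norm (frame_char m v t))
      \<le> (LINT v|gauss_frames m. ?h / 2 + (norm (frame_char m v t))\<^sup>2 / (2 * ?h))"
      using int2 by (intro integral_mono int1) auto
    also have "\<dots> = ?h / 2 + (LINT v|gauss_frames m. (norm (frame_char m v t))\<^sup>2) / (2 * ?h)"
      using int2 by (simp add: G.prob_space)
    also have "\<dots> \<le> ?h / 2 + C * ?h\<^sup>2 / (2 * ?h)"
      using C(2)[of t] h by (intro add_left_mono divide_right_mono) auto
    also have "\<dots> = (1 + C) / 2 * ?h" using h by (simp add: field_simps power2_eq_square)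
    finally show ?thesis .
  qed
  show ?thesis
  proof (rule P.Fubini_integrable)
    show "(\<lambda>(t, v). frame_char m v t) \<in> borel_measurable (frequencies m \<Otimes>\<^sub>M gauss_frames m)"
      by (simp add: split_beta')
    show "AE t in frequencies m. integrable (gauss_frames m) (\<lambda>v. case (t, v) of (t, v) \<Rightarrow> frame_char m v t)"
      using int1 by (auto simp: integrable_norm_iff)
    show "integrable (frequencies m) (\<lambda>t. LINT v|gauss_frames m. norm (case (t, v) of (t, v) \<Rightarrow> frame_char m v t))"
    proof (rule Bochner_Integration.integrable_bound)
      show "integrable (frequencies m) (\<lambda>t. (1 + C) / 2 * decay a m t)"
        by (intro integrable_mult_right integrable_decay assms)
      show "AE t in frequencies m. norm (LINT v|gauss_frames m. norm (case (t, v) of (t, v) \<Rightarrow> frame_char m v t))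
          \<le> norm ((1 + C) / 2 * decay a m t)"
        using le C(1) decay_pos[of a m] by (intro AE_I2) (auto simp: abs_mult less_imp_le)
      show "(\<lambda>t. LINT v|gauss_frames m. norm (case (t, v) of (t, v) \<Rightarrow> frame_char m v t))
          \<in> borel_measurable (frequencies m)"
        by (intro G.borel_measurable_lebesgue_integral) (simp add: split_beta')
    qed
  qed
qed

section \<open>The density at the origin and the covering property\<close>

text \<open>Up to the factor \<open>(2 * pi) ^ m\<close>, the inner integral is the density at the
  origin. Fubini turns its mean into the integral of \<open>\<psi>\<close>, which is strictly
  positive since \<mu> is nonzero.\<close>

lemma expectation_density_at_zero_nonzero:
  assumes int: "integrable (frequencies m \<Otimes>\<^sub>M gauss_frames m) (\<lambda>(t, v). frame_char m v t)"
    and nz: "emeasure \<mu> (space \<mu>) \<noteq> 0"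
  shows "(LINT v|gauss_frames m. LINT t|frequencies m. frame_char m v t) \<noteq> 0"
proof
  interpret G: prob_space "gauss_frames m :: (nat \<Rightarrow> 'a) measure" by (rule prob_space_gauss_frames)
  interpret L: sigma_finite_measure "frequencies m" by (rule sigma_finite_frequencies)
  interpret P: pair_sigma_finite "frequencies m" "gauss_frames m :: (nat \<Rightarrow> 'a) measure" ..
  let ?g = "\<lambda>t x::'a. exp (- (\<Sum>j<m. (t j)\<^sup>2) * (norm x)\<^sup>2 / 2)"
  define \<psi> where "\<psi> t = (LINT x|\<mu>. ?g t x)" for t
  have \<psi>: "\<psi> t > 0" for t
  proof -
    have i: "integrable \<mu> (?g t)"
      by (rule integrable_const_bound[of _ 1]) (auto simp: sum_nonneg)
    have "\<psi> t \<noteq> 0"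
    proof
      assume "\<psi> t = 0"
      then have "AE x in \<mu>. ?g t x = 0"
        unfolding \<psi>_def using integral_nonneg_eq_0_iff_AE[OF i] by simp
      then show False using nz by (simp add: AE_iff_measurable[OF sets.top])
    qed
    moreover have "\<psi> t \<ge> 0" unfolding \<psi>_def by (rule Bochner_Integration.integral_nonneg) simp
    ultimately show ?thesis by simp
  qed
  have int\<psi>: "integrable (frequencies m) \<psi>"
    using P.integrable_fst[OF int] unfolding expectation_frame_char \<psi>_def complex_of_real_integrable_eq .
  assume "(LINT v|gauss_frames m. LINT t|frequencies m. frame_char m v t) = 0"
  then have "(LINT t|frequencies m. \<psi> t) = 0"
    unfolding P.Fubini_integral[OF int] expectation_frame_char \<psi>_def integral_complex_of_real by simp
  then have "AE t in frequencies m. \<psi> t = 0"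
    using integral_nonneg_eq_0_iff_AE[OF int\<psi>] \<psi> by (auto simp: less_imp_le)
  then have "AE t in frequencies m. False"
    by (rule AE_mp) (use \<psi> in \<open>auto simp: less_le\<close>)
  then show False
    using emeasure_frequencies_nonzero[of m] by (simp add: AE_iff_measurable[OF sets.top])
qed

text \<open>Fourier inversion against the Gaussian mollifiers \<open>exp (- (\<sigma> n * t j)\<^sup>2 / 2)\<close>, which avoids
  knowing that the pushed-forward measure has a density.\<close>
lemma density_eq_zero:
  assumes int: "integrable (frequencies m) (frame_char m v)"
    and K: "compact K" "AE x in \<mu>. x \<in> K"
    and y: "\<And>x. x \<in> K \<Longrightarrow> \<exists>j<m. v j \<bullet> x \<noteq> y j"
  shows "(LINT t|frequencies m. iexp (- (\<Sum>j<m. t j * y j)) * frame_char m v t) = 0"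
proof -
  interpret L: sigma_finite_measure "frequencies m" by (rule sigma_finite_frequencies)
  interpret P: pair_sigma_finite "frequencies m" \<mu> ..
  \<comment> \<open>The squared distance from the coordinates of \<open>x\<close> to the missed
    target; compactness of \<open>K\<close> bounds it below by some
    \<open>\<delta> > 0\<close>.\<close>
  define g where "g x = (\<Sum>j<m. (v j \<bullet> x - y j)\<^sup>2)" for x
  have g_pos: "g x > 0" if "x \<in> K" for x
  proof -
    obtain j where "j < m" "v j \<bullet> x \<noteq> y j" using y[of x] \<open>x \<in> K\<close> by auto
    then show ?thesis unfolding g_def by (intro sum_pos2[of _ j]) auto
  qed
  obtain \<delta> where \<delta>: "\<delta> > 0" "\<And>x. x \<in> K \<Longrightarrow> \<delta> \<le> g x"
  proof (cases "K = {}")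
    case True
    then show ?thesis using that[of 1] by auto
  next
    case False
    have "continuous_on K g" unfolding g_def by (intro continuous_intros)
    then obtain x where "x \<in> K" "\<And>z. z \<in> K \<Longrightarrow> g x \<le> g z"
      using continuous_attains_inf[OF K(1) False] by blast
    then show ?thesis using that[of "g x"] g_pos by auto
  qed
  define \<sigma> where "\<sigma> n = 1 / real (Suc n)" for n
  have \<sigma>: "\<sigma> n > 0" for n by (simp add: \<sigma>_def)
  have \<sigma>_lim: "\<sigma> \<longlonglongrightarrow> 0" unfolding \<sigma>_def by (rule LIMSEQ_Suc[OF lim_1_over_n])
  define w where "w n t = (\<Prod>j<m. complex_of_real (exp (- (\<sigma> n * t j)\<^sup>2 / 2)))" for n and t :: "nat \<Rightarrow> real"
  have [measurable]: "w n \<in> borel_measurable (frequencies m)" for n unfolding w_def by measurable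
  have norm_w: "norm (w n t) \<le> 1" for n t
    unfolding w_def prod_norm[symmetric] by (intro prod_le_1) auto
  let ?I = "\<lambda>n. LINT t|frequencies m. w n t * (iexp (- (\<Sum>j<m. t j * y j)) * frame_char m v t)"
  let ?M = "measure \<mu> (space \<mu>)"
  \<comment> \<open>The mollifiers are at most 1 and tend to 1, so dominated convergence removes
    them.\<close>
  have conv: "?I \<longlonglongrightarrow> (LINT t|frequencies m. iexp (- (\<Sum>j<m. t j * y j)) * frame_char m v t)"
  proof (rule integral_dominated_convergence[where w = "\<lambda>t. norm (frame_char m v t)"])
    show "integrable (frequencies m) (\<lambda>t. norm (frame_char m v t))" using int by simp
    show "AE t in frequencies m. (\<lambda>n. w n t * (iexp (- (\<Sum>j<m. t j * y j)) * frame_char m v t))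
        \<longlonglongrightarrow> iexp (- (\<Sum>j<m. t j * y j)) * frame_char m v t"
    proof (rule AE_I2)
      fix t
      have "(\<lambda>n. w n t) \<longlonglongrightarrow> (\<Prod>j<m. complex_of_real (exp (- (0 * t j)\<^sup>2 / 2)))"
        unfolding w_def by (intro tendsto_intros \<sigma>_lim) auto
      then have "(\<lambda>n. w n t) \<longlonglongrightarrow> 1" by simp
      from tendsto_mult_right[OF this]
      show "(\<lambda>n. w n t * (iexp (- (\<Sum>j<m. t j * y j)) * frame_char m v t))
        \<longlonglongrightarrow> iexp (- (\<Sum>j<m. t j * y j)) * frame_char m v t" by simp
    qed
    fix n
    show "AE t in frequencies m. norm (w n t * (iexp (- (\<Sum>j<m. t j * y j)) * frame_char m v t))
        \<le> norm (frame_char m v t)"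
    proof (rule AE_I2)
      fix t
      have "norm (w n t * (iexp (- (\<Sum>j<m. t j * y j)) * frame_char m v t)) = norm (w n t) * norm (frame_char m v t)"
        unfolding norm_mult norm_exp_i_times by simp
      then show "norm (w n t * (iexp (- (\<Sum>j<m. t j * y j)) * frame_char m v t)) \<le> norm (frame_char m v t)"
        using norm_w[of n t] by (simp add: mult_left_le_one_le)
    qed
  qed measurable
  \<comment> \<open>Exchanging the integrals replaces the frequency integral by a Gaussian peak of
    width \<open>\<sigma> n\<close> around \<open>y\<close>, integrated over \<mu>.\<close>
  have I_eq: "?I n = (LINT x|\<mu>. (\<Prod>j<m. sqrt (2 * pi) / \<sigma> n * exp (- ((v j \<bullet> x - y j) / \<sigma> n)\<^sup>2 / 2)))" for n
  proof -
    let ?F = "\<lambda>t x. \<Prod>j<m. complex_of_real (exp (- (\<sigma> n * t j)\<^sup>2 / 2)) * iexp (t j * (v j \<bullet> x - y j))"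
    have F: "?F t x = w n t * (iexp (- (\<Sum>j<m. t j * y j)) * iexp (\<Sum>j<m. t j * (v j \<bullet> x)))" for t x
    proof -
      have "- (\<Sum>j<m. t j * y j) + (\<Sum>j<m. t j * (v j \<bullet> x)) = (\<Sum>j<m. t j * (v j \<bullet> x - y j))"
        by (simp add: right_diff_distrib sum_subtractf)
      then have "iexp (- (\<Sum>j<m. t j * y j)) * iexp (\<Sum>j<m. t j * (v j \<bullet> x)) = iexp (\<Sum>j<m. t j * (v j \<bullet> x - y j))"
        unfolding exp_add[symmetric] distrib_left[symmetric] of_real_add[symmetric] by simp
      then show ?thesis unfolding w_def prod.distrib iexp_sum[symmetric] by simp
    qed
    \<comment> \<open>The modulus is independent of \<open>x\<close>, so Fubini only needs
      integrability of the mollifier.\<close>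
    have nF: "norm (?F t x) = norm (w n t)" for t x
      unfolding F norm_mult norm_exp_i_times by simp
    have iw: "integrable (frequencies m) (w n)"
      using integrable_frequencies_gaussian[OF \<sigma>[of n], of m "\<lambda>_. 0"] by (simp add: w_def[abs_def])
    have "integrable (frequencies m \<Otimes>\<^sub>M \<mu>) (\<lambda>(t, x). ?F t x)"
    proof (rule P.Fubini_integrable)
      show "(\<lambda>(t, x). ?F t x) \<in> borel_measurable (frequencies m \<Otimes>\<^sub>M \<mu>)" by measurable
      show "integrable (frequencies m) (\<lambda>t. LINT x|\<mu>. norm (case (t, x) of (t, x) \<Rightarrow> ?F t x))"
        unfolding case_prod_conv nF using iw by simp
      show "AE t in frequencies m. integrable \<mu> (\<lambda>x. case (t, x) of (t, x) \<Rightarrow> ?F t x)"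
        unfolding case_prod_conv
      proof (rule AE_I2)
        fix t
        show "integrable \<mu> (?F t)"
          by (rule integrable_const_bound[of _ 1]) (simp_all only: nF norm_w, simp, measurable)
      qed
    qed
    from P.Fubini_integral[OF this]
    have "(LINT x|\<mu>. LINT t|frequencies m. ?F t x) = (LINT t|frequencies m. LINT x|\<mu>. ?F t x)" .
    also have "\<dots> = ?I n"
      unfolding F frame_char_def by simp
    finally show ?thesis
      unfolding integral_frequencies_gaussian[OF \<sigma>] integral_complex_of_real by simp
  qed
  have I_le: "norm (?I n) \<le> (sqrt (2 * pi) / \<sigma> n) ^ m * exp (- \<delta> / (2 * (\<sigma> n)\<^sup>2)) * ?M" for n
  proof -
    let ?H = "\<lambda>x. \<Prod>j<m. sqrt (2 * pi) / \<sigma> n * exp (- ((v j \<bullet> x - y j) / \<sigma> n)\<^sup>2 / 2)"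
    let ?c = "(sqrt (2 * pi) / \<sigma> n) ^ m * exp (- \<delta> / (2 * (\<sigma> n)\<^sup>2))"
    have H: "?H x = (sqrt (2 * pi) / \<sigma> n) ^ m * exp (- g x / (2 * (\<sigma> n)\<^sup>2))" for x
    proof -
      have "(\<Sum>j<m. - ((v j \<bullet> x - y j) / \<sigma> n)\<^sup>2 / 2) = - g x / (2 * (\<sigma> n)\<^sup>2)"
        unfolding g_def sum_negf[symmetric] sum_divide_distrib
        by (intro sum.cong) (auto simp: power_divide mult.commute)
      then show ?thesis unfolding prod.distrib by (simp add: exp_sum[symmetric])
    qed
    have H_le: "norm (?H x) \<le> ?c" if "x \<in> K" for x
    proof -
      have "norm (?H x) = ?H x" unfolding H using \<sigma>[of n] by simp
      also have "\<dots> \<le> ?c" unfolding H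
        using \<sigma>[of n] \<delta>(2)[OF that] by (intro mult_left_mono) (auto intro!: divide_right_mono)
      finally show ?thesis .
    qed
    have AEle: "AE x in \<mu>. norm (?H x) \<le> ?c" using K(2) by eventually_elim (rule H_le)
    have iH: "integrable \<mu> ?H"
      by (rule integrable_const_bound[OF AEle]) measurable
    have "norm (?I n) = norm (LINT x|\<mu>. ?H x)" unfolding I_eq by simp
    also have "\<dots> \<le> (LINT x|\<mu>. norm (?H x))" by (rule integral_norm_bound)
    also have "\<dots> \<le> (LINT x|\<mu>. ?c)"
      using AEle by (intro integral_mono_AE integrable_norm iH) auto
    finally show ?thesis by (simp add: mult_ac)
  qed
  have "(\<lambda>n. (sqrt (2 * pi) / \<sigma> n) ^ m * exp (- \<delta> / (2 * (\<sigma> n)\<^sup>2)) * ?M) \<longlonglongrightarrow> 0"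
  proof -
    \<comment> \<open>As \<open>\<sigma> n = 1 / real (Suc n)\<close>, the decay
      \<open>exp (- \<delta> / 2 * (real (Suc n))\<^sup>2)\<close> is at most
      \<open>exp (- ?u n)\<close>, which beats the growth of order \<open>m\<close>. The constant
      \<open>?A\<close> rewrites that growth as a power of \<open>?u n\<close>.\<close>
    let ?u = "\<lambda>n. \<delta> / 2 * real (Suc n)"
    let ?A = "(sqrt (2 * pi) * (2 / \<delta>)) ^ m * ?M"
    have "filterlim ?u at_top sequentially"
      using \<delta>(1) by (intro filterlim_tendsto_pos_mult_at_top[OF tendsto_const] filterlim_compose[OF filterlim_real_sequentially filterlim_Suc]) auto
    from filterlim_compose[OF tendsto_power_div_exp_0[of m] this]
    have lim: "(\<lambda>n. ?A * (?u n ^ m / exp (?u n))) \<longlonglongrightarrow> 0"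
      by (rule tendsto_mult_right_zero)
    show ?thesis
    proof (rule Lim_null_comparison[OF _ lim], rule always_eventually, rule allI)
      fix n
      have "real (Suc n) * 1 \<le> real (Suc n) * real (Suc n)" by (intro mult_left_mono) auto
      then have "\<delta> / 2 * real (Suc n) \<le> \<delta> / 2 * (real (Suc n))\<^sup>2"
        using \<delta>(1) by (intro mult_left_mono) (auto simp: power2_eq_square)
      then have "exp (- \<delta> / (2 * (\<sigma> n)\<^sup>2)) \<le> exp (- ?u n)"
        by (simp add: \<sigma>_def power_divide del: of_nat_Suc)
      then have "(sqrt (2 * pi) * real (Suc n)) ^ m * exp (- \<delta> / (2 * (\<sigma> n)\<^sup>2)) * ?M
          \<le> (sqrt (2 * pi) * real (Suc n)) ^ m * exp (- ?u n) * ?M"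
        by (intro mult_right_mono mult_left_mono) auto
      also have "\<dots> = ?A * (?u n ^ m / exp (?u n))"
        using \<delta>(1) by (simp add: power_mult_distrib power_divide exp_minus field_simps del: of_nat_Suc)
      finally show "norm ((sqrt (2 * pi) / \<sigma> n) ^ m * exp (- \<delta> / (2 * (\<sigma> n)\<^sup>2)) * ?M) \<le> ?A * (?u n ^ m / exp (?u n))"
        by (simp add: \<sigma>_def abs_mult power_abs del: of_nat_Suc)
    qed
  qed
  then have "?I \<longlonglongrightarrow> 0"
    by (rule Lim_null_comparison[OF always_eventually[OF allI[OF I_le]]])
  with conv show ?thesis by (rule LIMSEQ_unique)
qed

text \<open>If no cube around 0 were covered, missed targets \<open>y n\<close> would tend to 0. The
  density vanishes at each of them, hence at 0 by continuity.\<close>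

lemma density_nonzero_imp_covers_zero:
  assumes int: "integrable (frequencies m) (frame_char m v)"
    and K: "compact K" "AE x in \<mu>. x \<in> K"
    and nz: "(LINT t|frequencies m. frame_char m v t) \<noteq> 0"
  shows "\<exists>\<delta>>0. covers_zero m K v \<delta>"
proof (rule ccontr)
  assume "\<not> ?thesis"
  then have "\<not> covers_zero m K v (1 / real (Suc n))" for n by auto
  then have "\<forall>n. \<exists>y. (\<forall>j<m. \<bar>y j\<bar> < 1 / real (Suc n)) \<and> (\<forall>x\<in>K. \<exists>j<m. v j \<bullet> x \<noteq> y j)"
    unfolding covers_zero_def by simp
  from choice[OF this] obtain y where
    "\<forall>n. (\<forall>j<m. \<bar>y n j\<bar> < 1 / real (Suc n)) \<and> (\<forall>x\<in>K. \<exists>j<m. v j \<bullet> x \<noteq> y n j)" ..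
  then have y: "\<And>n j. j < m \<Longrightarrow> \<bar>y n j\<bar> < 1 / real (Suc n)"
    "\<And>n x. x \<in> K \<Longrightarrow> \<exists>j<m. v j \<bullet> x \<noteq> y n j"
    by simp_all
  have y_lim: "(\<lambda>n. y n j) \<longlonglongrightarrow> 0" if "j < m" for j
    using y(1)[OF that]
    by (intro Lim_null_comparison[OF always_eventually LIMSEQ_Suc[OF lim_1_over_n]]) (auto intro: less_imp_le)
  \<comment> \<open>Continuity of the Fourier integral at the origin, dominated by the modulus of
    \<open>frame_char m v\<close>.\<close>
  have "(\<lambda>n. LINT t|frequencies m. iexp (- (\<Sum>j<m. t j * y n j)) * frame_char m v t)
     \<longlonglongrightarrow> (LINT t|frequencies m. frame_char m v t)"
  proof (rule integral_dominated_convergence[where w = "\<lambda>t. norm (frame_char m v t)"])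
    show "integrable (frequencies m) (\<lambda>t. norm (frame_char m v t))" using int by simp
    show "AE t in frequencies m. (\<lambda>n. iexp (- (\<Sum>j<m. t j * y n j)) * frame_char m v t)
        \<longlonglongrightarrow> frame_char m v t"
    proof (rule AE_I2)
      fix t
      have "(\<lambda>n. iexp (- (\<Sum>j<m. t j * y n j)) * frame_char m v t)
          \<longlonglongrightarrow> iexp (- (\<Sum>j<m. t j * 0)) * frame_char m v t"
        by (intro tendsto_intros y_lim) auto
      then show "(\<lambda>n. iexp (- (\<Sum>j<m. t j * y n j)) * frame_char m v t)
          \<longlonglongrightarrow> frame_char m v t" by simp
    qed
    fix n
    show "AE t in frequencies m. norm (iexp (- (\<Sum>j<m. t j * y n j)) * frame_char m v t)
        \<le> norm (frame_char m v t)"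
      unfolding norm_mult norm_exp_i_times by simp
  qed measurable
  moreover have "(LINT t|frequencies m. iexp (- (\<Sum>j<m. t j * y n j)) * frame_char m v t) = 0" for n
    using y(2) by (intro density_eq_zero[OF int K]) auto
  ultimately have "(\<lambda>n. 0) \<longlonglongrightarrow> (LINT t|frequencies m. frame_char m v t)" by simp
  with nz show False using LIMSEQ_unique tendsto_const by blast
qed

end

section \<open>Positivity of the probability of the covering event\<close>

theorem theorem3p4:
  fixes \<mu> :: "'a::euclidean_space measure" and m :: nat and s :: real
  assumes "1 \<le> m" and "m < DIM('a)"
    and "2 * real m < s" and "s < real DIM('a)"
    and "sets \<mu> = sets borel"
    and "finite_measure \<mu>"
    and "emeasure \<mu> (space \<mu>) \<noteq> 0"
    and "compact (spt \<mu>)"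
    and "energy s \<mu> < \<infinity>"
  shows "gamma_nm m {V \<in> grassmannian m. (0::'a) \<in> rel_int_in V (proj V ` spt \<mu>)} > 0"
proof -
  interpret finite_measure \<mu> by fact
  interpret finite_borel_measure \<mu> by standard fact
  interpret G: prob_space "gauss_frames m :: (nat \<Rightarrow> 'a) measure" by (rule prob_space_gauss_frames)
  interpret L: sigma_finite_measure "frequencies m" by (rule sigma_finite_frequencies)
  interpret P: pair_sigma_finite "frequencies m" "gauss_frames m :: (nat \<Rightarrow> 'a) measure" ..
  let ?S = "{v \<in> space (gauss_frames m). \<exists>\<delta>>0. covers_zero m (spt \<mu>) v \<delta>}"
  have "sets (gauss_frames m :: (nat \<Rightarrow> 'a) measure) = sets (PiM {..<m} (\<lambda>_. borel))"
    by (rule sets_PiM_cong) auto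
  then have "Measurable.pred (gauss_frames m) (\<lambda>v. \<exists>\<delta>>0. covers_zero m (spt \<mu>) v \<delta>)"
    using measurable_covers_zero[OF assms(8), of m] by (simp cong: measurable_cong_sets)
  then have S: "?S \<in> sets (gauss_frames m)" by (simp add: pred_def)
  \<comment> \<open>The two implications between covering and interior make the events equal as
    sets, including membership in \<open>grassmannian m\<close>.\<close>
  have "gamma_nm m {V \<in> grassmannian m. (0::'a) \<in> rel_int_in V (proj V ` spt \<mu>)}
      = emeasure (gauss_frames m) ?S"
    unfolding gamma_nm_def
    using covers_zero_imp_interior interior_imp_covers_zero
    by (intro arg_cong2[where f = emeasure] Collect_cong refl) blast
  moreover have "emeasure (gauss_frames m) ?S \<noteq> 0"
  proof
    assume "emeasure (gauss_frames m) ?S = 0"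
    then have no_cover: "AE v in gauss_frames m. \<not> (\<exists>\<delta>>0. covers_zero m (spt \<mu>) v \<delta>)"
      using S by (subst AE_iff_measurable[OF S]) auto
    \<comment> \<open>The parameter \<open>a = s / (2 * real m)\<close> matches the energy exponent,
      and \<open>a > 1\<close> says exactly that \<open>2 * real m < s\<close>.\<close>
    have "s = 2 * (s / (2 * real m)) * real m" "s / (2 * real m) > 1"
      using assms(1,3) by auto
    then have int: "integrable (frequencies m \<Otimes>\<^sub>M gauss_frames m) (\<lambda>(t, v). frame_char m v t)"
      using integrable_frame_char[of "s / (2 * real m)" m] assms(9) by simp
    have spt: "AE x in \<mu>. x \<in> spt \<mu>"
      using AE_not_in[OF null_sets_Compl_spt[OF assms(5)]] by simp
    \<comment> \<open>Joint integrability makes almost every \<open>frame_char m v\<close>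
      integrable, so almost surely failing to cover would make the density at the origin vanish
      almost surely.\<close>
    have "AE v in gauss_frames m. (LINT t|frequencies m. frame_char m v t) = 0"
      using P.AE_integrable_snd[OF int] no_cover
      by eventually_elim (use density_nonzero_imp_covers_zero[OF _ assms(8) spt] in auto)
    then have "(LINT v|gauss_frames m. LINT t|frequencies m. frame_char m v t) = 0"
      by (rule integral_eq_zero_AE)
    then show False
      using expectation_density_at_zero_nonzero[OF int assms(7)] by simp
  qed
  ultimately show ?thesis by (simp add: zero_less_iff_neq_zero)
qed

end
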